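(* Fix $k_d\in(-\sqrt2,0)$. For $k_f>0$ sufficiently small let $$h_o(k_f)=\min\{h>0:\ \forall s'\in\Gamma_d,\ \forall s''\in\Gamma_f,\ I(s',s'')\subset D_4(s'')\},$$ where $\Gamma_d$, $\Gamma_f$ (which depend on $h$, $k_d$, $k_f$), $I(s',s'')$ and $D_4(s'')$ are as described in the context. Then $h_o(k_f)\sim k_f$ as $k_f\to0$, i.e. the ratio $h_o(k_f)/k_f$ is bounded away from $0$ and from $\infty$ as $k_f\to0^+$.
   Context: **Table boundary.** Given $h>0$, $k_d\in(-\sqrt2,0)$, $k_f>0$: take the unit square $[0,1]\times[h,1+h]$ and replace its left, upper and right sides by circular minor arcs of radius $1/|k_d|$ with the same endpoints, bulging towards the inside of the square; the union of these three (dispersing) arcs is $\Gamma_d$. The focusing arc $\Gamma_f$ is the circular minor arc of radius $1/k_f$ with endpoints $(0,0)$ and $(1,0)$, bulging downward. (The billiard table $\Omega$ contains the region delimited by the three dispersing arcs, the rectangle $[0,1]\times[0,h]$ under it, and the region between $[0,1]\times\{0\}$ and $\Gamma_f$; the table has moreover two rectangular strips $[-l,0]\times[0,h]$ and $[1,1+l]\times[0,h]$ of height $h$, open towards the central rectangle, whose length $l$ plays no role here.) The curvature is $k(s)=k_d$ on $\Gamma_d$ and $k(s)=k_f$ on $\Gamma_f$. **Discs.** For a point $s\in\Gamma_d\cup\Gamma_f$ and $\beta>0$ (resp. $\beta<0$), $D_\beta(s)$ is the closed disc of radius $1/|\beta k(s)|$ tangent to the boundary arc at $s$ on the internal (resp.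 external) side of $\Omega$. For $s'\in\Gamma_d$, $s''\in\Gamma_f$, $I(s',s'')$ is the intersection of the straight line through $s'$ and $s''$ with the disc $D_{-2}(s')$. At endpoints of arcs, the tangent line of the arc is used. *)

theory Defs
  imports "HOL-Analysis.Analysis" "HOL-Library.Landau_Symbols"
begin

text \<open>A circular minor arc is given by its endpoints, its signed curvature and the unit vector,
  orthogonal to the chord, that points to the side of the chord to which the arc bulges.
  As usual for billiards, the curvature is negative if the arc is dispersing (its centre lies on
  the external side of the table) and positive if it is focusing (its centre lies on the internal
  side).\<close>

datatype circ_arc =
  Circ_Arc (pt1: "real \<times> real") (pt2: "real \<times> real") (curv: real) (bulge: "real \<times> real")

text \<open>The radius \<open>1 / \<bar>curv A\<bar>\<close> has to exceed half the length of the chord. The centre of the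
  circle and the minor arc lie on opposite sides of the chord.\<close>

definition arc_centre :: "circ_arc \<Rightarrow> real \<times> real" where
  "arc_centre A = midpoint (pt1 A) (pt2 A)
     - sqrt ((1 / curv A)\<^sup>2 - (dist (pt1 A) (pt2 A) / 2)\<^sup>2) *\<^sub>R bulge A"

definition arc_points :: "circ_arc \<Rightarrow> (real \<times> real) set" where
  "arc_points A = {s \<in> sphere (arc_centre A) (1 / \<bar>curv A\<bar>). (s - pt1 A) \<bullet> bulge A \<ge> 0}"

text \<open>The unit normal of the arc at \<open>s\<close> pointing to the internal side of the table.\<close>

definition inner_normal :: "circ_arc \<Rightarrow> real \<times> real \<Rightarrow> real \<times> real" where
  "inner_normal A s = sgn (curv A) *\<^sub>R sgn (arc_centre A - s)"

text \<open>The disc \<open>D\<^sub>\<beta>(s)\<close>. The arc is an argument because two arcs, with different tangent lines,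
  meet at each upper corner of the table.\<close>

definition tangent_disc :: "circ_arc \<Rightarrow> real \<Rightarrow> real \<times> real \<Rightarrow> (real \<times> real) set" where
  "tangent_disc A \<beta> s =
     cball (s + (sgn \<beta> / \<bar>\<beta> * curv A\<bar>) *\<^sub>R inner_normal A s) (1 / \<bar>\<beta> * curv A\<bar>)"

definition dispersing_arcs :: "real \<Rightarrow> real \<Rightarrow> circ_arc set" where
  "dispersing_arcs kd h =
    {Circ_Arc (0, h) (0, 1 + h) kd (1, 0),
     Circ_Arc (0, 1 + h) (1, 1 + h) kd (0, -1),
     Circ_Arc (1, h) (1, 1 + h) kd (-1, 0)}"

definition focusing_arc :: "real \<Rightarrow> circ_arc" where
  "focusing_arc kf = Circ_Arc (0, 0) (1, 0) kf (0, -1)"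

text \<open>\<open>I(s', s'')\<close>, where \<open>s'\<close> is a point of the dispersing arc \<open>A\<close>.\<close>

definition line_in_disc :: "circ_arc \<Rightarrow> real \<times> real \<Rightarrow> real \<times> real \<Rightarrow> (real \<times> real) set" where
  "line_in_disc A s' s'' = affine hull {s', s''} \<inter> tangent_disc A (-2) s'"

definition good_heights :: "real \<Rightarrow> real \<Rightarrow> real set" where
  "good_heights kd kf = {h. h > 0 \<and>
     (\<forall>A \<in> dispersing_arcs kd h. \<forall>s' \<in> arc_points A. \<forall>s'' \<in> arc_points (focusing_arc kf).
        line_in_disc A s' s'' \<subseteq> tangent_disc (focusing_arc kf) 4 s'')}"

text \<open>Unspecified if \<^term>\<open>good_heights kd kf\<close> has no minimum.\<close>

definition h_o :: "real \<Rightarrow> real \<Rightarrow> real" where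
  "h_o kd kf = (LEAST h. h \<in> good_heights kd kf)"

end

theory Submission
  imports Defs
begin

text \<open>A point \<open>q\<close> lies in \<open>D\<^sub>4(s'')\<close> iff \<open>\<bar>q - s''\<bar>\<^sup>2 \<le> (q - s'') \<bullet> (c - s'') / 2\<close>, where \<open>c\<close>, the centre of
  the focusing arc, has height about \<open>1 / kf\<close> above the middle of the base. Every point of
  \<open>I(s', s'')\<close> has height at least \<open>h\<close> and bounded distance from \<open>s''\<close>, so the inequality holds as soon
  as \<open>h / kf\<close> exceeds a constant. Conversely, \<open>s' = (0, h)\<close> and \<open>s'' = (1, 0)\<close> force
  \<open>h \<ge> 3 / 2 * kf\<close>. The minimum exists because, in a parametrisation of \<open>I(s', s'')\<close> that depends
  continuously on \<open>h\<close>, the condition is an intersection of closed ones, and \<open>h\<close> stays away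
  from \<open>0\<close>.\<close>

section \<open>Circular arcs, their translations and their caps\<close>

text \<open>These conditions make the radicand in \<open>arc_centre\<close> nonnegative and put the
  centre at distance \<open>1 / \<bar>curv A\<bar>\<close> from both endpoints.\<close>

definition proper_arc :: "circ_arc \<Rightarrow> bool" where
  "proper_arc A \<longleftrightarrow> curv A \<noteq> 0 \<and> norm (bulge A) = 1 \<and> (pt2 A - pt1 A) \<bullet> bulge A = 0
     \<and> dist (pt1 A) (pt2 A) / 2 \<le> 1 / \<bar>curv A\<bar>"

definition translate_arc :: "real \<times> real \<Rightarrow> circ_arc \<Rightarrow> circ_arc" where
  "translate_arc v A = Circ_Arc (pt1 A + v) (pt2 A + v) (curv A) (bulge A)"

lemma translate_arc_simps [simp]:
  "pt1 (translate_arc v A) = pt1 A + v" "pt2 (translate_arc v A) = pt2 A + v"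
  "curv (translate_arc v A) = curv A" "bulge (translate_arc v A) = bulge A"
  by (simp_all add: translate_arc_def)

lemma midpoint_translate: "midpoint (a + v) (b + v) = midpoint a b + (v :: 'a :: real_vector)"
  by (simp add: midpoint_def algebra_simps flip: scaleR_add_left)

lemma arc_centre_translate: "arc_centre (translate_arc v A) = arc_centre A + v"
  by (simp add: arc_centre_def midpoint_translate dist_norm)

lemma arc_points_translate: "arc_points (translate_arc v A) = (\<lambda>s. s + v) ` arc_points A"
proof -
  have "s \<in> arc_points (translate_arc v A) \<longleftrightarrow> s - v \<in> arc_points A" for s
    by (simp add: arc_points_def arc_centre_translate dist_norm algebra_simps)
  moreover have "s \<in> (\<lambda>s. s + v) ` arc_points A \<longleftrightarrow> s - v \<in> arc_points A" for s
    using image_eqI[of s "\<lambda>s. s + v" "s - v"] by auto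
  ultimately show ?thesis
    by blast
qed

text \<open>Lets points of the dispersing arcs be indexed by the arcs at height 0, a set independent
  of \<open>h\<close>, when closedness in \<open>h\<close> is at stake.\<close>

lemma dispersing_arcs_translate:
  "dispersing_arcs kd h = translate_arc (0, h) ` dispersing_arcs kd 0"
  by (simp add: dispersing_arcs_def translate_arc_def)

lemma proper_dispersing_arc:
  assumes "A \<in> dispersing_arcs kd h" "- 2 \<le> kd" "kd < 0"
  shows "proper_arc A"
proof -
  have "1 / 2 \<le> 1 / \<bar>kd\<bar>"
    using assms by (simp add: field_simps)
  with assms show ?thesis
    by (auto simp: dispersing_arcs_def proper_arc_def dist_norm norm_Pair)
qed

lemma proper_focusing_arc:
  assumes "0 < kf" "kf \<le> 2"
  shows "proper_arc (focusing_arc kf)"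
  using assms by (auto simp: focusing_arc_def proper_arc_def dist_norm norm_Pair field_simps)

text \<open>The cap of a minor arc lies in the disc that has the chord as diameter. With
  \<open>m\<close> the midpoint, \<open>l\<close> half the chord and \<open>a\<close> the distance
  from \<open>m\<close> to the centre, the squared radius is \<open>a\<^sup>2 + l\<^sup>2\<close>,
  while on the bulging side moving the origin from the centre to \<open>m\<close> drops at least
  \<open>a\<^sup>2\<close>.\<close>

lemma arc_cap_subset_cball:
  assumes "proper_arc A" "z \<in> cball (arc_centre A) (1 / \<bar>curv A\<bar>)" "(z - pt1 A) \<bullet> bulge A \<ge> 0"
  shows "dist z (midpoint (pt1 A) (pt2 A)) \<le> dist (pt1 A) (pt2 A) / 2"
proof -
  define m where "m = midpoint (pt1 A) (pt2 A)"
  define l where "l = dist (pt1 A) (pt2 A) / 2"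
  define a where "a = sqrt ((1 / curv A)\<^sup>2 - l\<^sup>2)"
  have "l\<^sup>2 \<le> (1 / \<bar>curv A\<bar>)\<^sup>2"
    using assms(1) by (intro power_mono) (auto simp: proper_arc_def l_def)
  then have a2: "a\<^sup>2 = (1 / \<bar>curv A\<bar>)\<^sup>2 - l\<^sup>2" and "a \<ge> 0"
    by (auto simp: a_def power_divide)
  have "m - pt1 A = (1/2) *\<^sub>R (pt2 A - pt1 A)"
    by (simp add: m_def midpoint_def algebra_simps flip: scaleR_add_left)
  then have "(m - pt1 A) \<bullet> bulge A = 0"
    using assms(1) by (simp add: proper_arc_def)
  with assms(3) have nonneg: "(z - m) \<bullet> bulge A \<ge> 0"
    by (simp add: inner_diff_left)
  have c: "arc_centre A = m - a *\<^sub>R bulge A"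
    by (simp add: arc_centre_def m_def a_def l_def)
  have "(norm (z - m))\<^sup>2 + 2 * a * ((z - m) \<bullet> bulge A) + a\<^sup>2 = (norm (z - arc_centre A))\<^sup>2"
  proof -
    have "z - arc_centre A = (z - m) + a *\<^sub>R bulge A"
      by (simp add: c)
    moreover have "bulge A \<bullet> bulge A = 1"
      using assms(1) by (simp add: proper_arc_def norm_eq_1)
    ultimately show ?thesis
      unfolding power2_norm_eq_inner \<open>z - arc_centre A = _\<close>
      by (simp only: inner_add_left inner_add_right inner_scaleR_left inner_scaleR_right
          inner_commute[of "bulge A" "z - m"] power2_eq_square)
        (simp add: algebra_simps)
  qed
  also have "\<dots> \<le> (1 / \<bar>curv A\<bar>)\<^sup>2"
    using assms(2) by (intro power_mono) (auto simp: dist_norm norm_minus_commute)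
  finally have "(norm (z - m))\<^sup>2 \<le> l\<^sup>2"
    using a2 nonneg \<open>a \<ge> 0\<close> mult_nonneg_nonneg[of "2 * a" "(z - m) \<bullet> bulge A"] by linarith
  then have "norm (z - m) \<le> l"
    by (rule power2_le_imp_le) (simp add: l_def)
  then show ?thesis
    by (simp add: m_def l_def dist_norm)
qed

lemma arc_points_subset_cap:
  assumes "s \<in> arc_points A"
  shows "s \<in> cball (arc_centre A) (1 / \<bar>curv A\<bar>)" "(s - pt1 A) \<bullet> bulge A \<ge> 0"
  using assms by (auto simp: arc_points_def)

section \<open>Tangent discs as quadratic inequalities\<close>

text \<open>The disc has centre \<open>s + k *\<^sub>R w\<close> and \<open>s\<close> on its
  boundary, so expanding the square cancels the squared radius. The factor is 1 for
  \<open>D\<^sub>-\<^sub>2\<close> on a dispersing arc and 1/2 for \<open>D\<^sub>4\<close> on the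
  focusing arc.\<close>

lemma mem_tangent_disc:
  assumes "s \<in> arc_points A" "curv A \<noteq> 0" "\<beta> \<noteq> 0"
  shows "q \<in> tangent_disc A \<beta> s \<longleftrightarrow>
    (norm (q - s))\<^sup>2 \<le> (2 * sgn (curv A) / \<beta>) * ((q - s) \<bullet> (arc_centre A - s))"
proof -
  define k where "k = sgn (curv A) / \<beta>"
  define w where "w = arc_centre A - s"
  have nw: "norm w = 1 / \<bar>curv A\<bar>"
    using assms(1) by (auto simp: arc_points_def w_def dist_norm)
  have "(sgn \<beta> / \<bar>\<beta> * curv A\<bar>) *\<^sub>R inner_normal A s = k *\<^sub>R w"
  proof -
    have "(sgn \<beta> / \<bar>\<beta> * curv A\<bar>) * (sgn (curv A) * \<bar>curv A\<bar>) = k"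
      using assms by (auto simp: k_def sgn_if abs_mult)
    moreover have "inner_normal A s = (sgn (curv A) * \<bar>curv A\<bar>) *\<^sub>R w"
      by (simp add: inner_normal_def sgn_div_norm[of w] nw flip: w_def)
    ultimately show ?thesis
      by simp
  qed
  moreover have "1 / \<bar>\<beta> * curv A\<bar> = norm (k *\<^sub>R w)"
    using assms by (simp add: k_def nw abs_mult abs_sgn_eq)
  ultimately have "q \<in> tangent_disc A \<beta> s \<longleftrightarrow> norm ((q - s) - k *\<^sub>R w) \<le> norm (k *\<^sub>R w)"
    by (simp add: tangent_disc_def dist_norm norm_minus_commute algebra_simps)
  also have "\<dots> \<longleftrightarrow> (norm ((q - s) - k *\<^sub>R w))\<^sup>2 \<le> (norm (k *\<^sub>R w))\<^sup>2"
    by (simp add: abs_le_square_iff)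
  also have "(norm ((q - s) - k *\<^sub>R w))\<^sup>2
      = (norm (q - s))\<^sup>2 - 2 * k * ((q - s) \<bullet> w) + (norm (k *\<^sub>R w))\<^sup>2"
    unfolding power2_norm_eq_inner by (simp add: inner_diff_left inner_diff_right inner_commute algebra_simps)
  finally show ?thesis
    by (simp add: k_def w_def)
qed

text \<open>This disc has the segment from \<open>s\<close> to the centre of the arc as diameter,
  hence is internally tangent at \<open>s\<close> to the full disc of the arc.\<close>

lemma dispersing_disc_subset:
  assumes "s \<in> arc_points A" "curv A < 0" "q \<in> tangent_disc A (- 2) s"
  shows "q \<in> cball (arc_centre A) (1 / \<bar>curv A\<bar>)" "dist q s \<le> 1 / \<bar>curv A\<bar>"
proof -
  define w where "w = arc_centre A - s"
  have nw: "norm w = 1 / \<bar>curv A\<bar>"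
    using assms(1) by (auto simp: arc_points_def w_def dist_norm)
  have q: "(norm (q - s))\<^sup>2 \<le> (q - s) \<bullet> w"
    using assms by (simp add: mem_tangent_disc w_def)
  have "(norm (q - s - w))\<^sup>2 = (norm (q - s))\<^sup>2 - 2 * ((q - s) \<bullet> w) + (norm w)\<^sup>2"
    unfolding power2_norm_eq_inner by (simp add: inner_diff_left inner_diff_right inner_commute)
  also have "\<dots> \<le> (norm w)\<^sup>2"
    using q zero_le_power2[of "norm (q - s)"] by linarith
  finally have "norm (q - s - w) \<le> norm w"
    by (rule power2_le_imp_le) simp
  then show "q \<in> cball (arc_centre A) (1 / \<bar>curv A\<bar>)"
    using nw by (simp add: w_def dist_norm norm_minus_commute)
  have "norm (q - s) * norm (q - s) \<le> norm (q - s) * norm w"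
    using q norm_cauchy_schwarz[of "q - s" w] by (simp add: power2_eq_square)
  then have "norm (q - s) \<le> norm w"
    by (cases "q = s") auto
  then show "dist q s \<le> 1 / \<bar>curv A\<bar>"
    using nw by (simp add: dist_norm)
qed

section \<open>Position of the caps, the focusing arc and the chords\<close>

text \<open>The cap is within 1/2 of the midpoint of its chord, and that midpoint has height
  \<open>h + 1/2\<close> for the side arcs and \<open>h + 1\<close> for the upper one.\<close>

lemma dispersing_cap_height:
  assumes "A \<in> dispersing_arcs kd h" "- 2 \<le> kd" "kd < 0"
    and "z \<in> cball (arc_centre A) (1 / \<bar>curv A\<bar>)" "(z - pt1 A) \<bullet> bulge A \<ge> 0"
  shows "h \<le> snd z"
proof -
  have "dist z (midpoint (pt1 A) (pt2 A)) \<le> 1 / 2"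
    using arc_cap_subset_cball[OF proper_dispersing_arc assms(4,5)] assms(1-3)
    by (auto simp: dispersing_arcs_def dist_norm norm_Pair)
  moreover have "snd (midpoint (pt1 A) (pt2 A)) \<ge> h + 1 / 2"
    using assms(1) by (auto simp: dispersing_arcs_def midpoint_def field_simps)
  ultimately show ?thesis
    using dist_snd_le[of z "midpoint (pt1 A) (pt2 A)"] unfolding dist_real_def by linarith
qed

lemma dispersing_point_height:
  assumes "A \<in> dispersing_arcs kd h" "- 2 \<le> kd" "kd < 0" "s \<in> arc_points A"
  shows "h \<le> snd s"
  using dispersing_cap_height[OF assms(1-3) arc_points_subset_cap[OF assms(4)]] .

lemma focusing_arc_simps [simp]:
  "pt1 (focusing_arc kf) = (0, 0)" "pt2 (focusing_arc kf) = (1, 0)"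
  "curv (focusing_arc kf) = kf" "bulge (focusing_arc kf) = (0, -1)"
  by (simp_all add: focusing_arc_def)

lemma focusing_centre:
  "arc_centre (focusing_arc kf) = (1 / 2, sqrt ((1 / kf)\<^sup>2 - 1 / 4))"
  by (simp add: arc_centre_def midpoint_def dist_norm norm_Pair power2_eq_square)

lemma focusing_point:
  assumes "0 < kf" "kf \<le> 2" "s \<in> arc_points (focusing_arc kf)"
  shows "snd s \<le> 0" "dist s (1 / 2, 0) \<le> 1 / 2" "0 \<le> fst s" "fst s \<le> 1"
proof -
  show "snd s \<le> 0"
    using assms(3) by (cases s) (auto simp: arc_points_def)
  show d: "dist s (1 / 2, 0) \<le> 1 / 2"
    using arc_cap_subset_cball[OF proper_focusing_arc[OF assms(1,2)] arc_points_subset_cap[OF assms(3)]]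
    by (simp add: midpoint_def dist_norm norm_Pair)
  have "\<bar>fst s - 1 / 2\<bar> \<le> 1 / 2"
    using dist_fst_le[of s "(1 / 2, 0)"] d by (simp add: dist_real_def)
  then show "0 \<le> fst s" "fst s \<le> 1"
    by linarith+
qed

text \<open>The half-planes of the three arcs are x \<ge> 0, y \<le> 1 + h and x \<le> 1.\<close>

lemma focusing_point_below_cap:
  assumes "A \<in> dispersing_arcs kd h" "0 < h"
    and "0 < kf" "kf \<le> 2" "s \<in> arc_points (focusing_arc kf)"
  shows "(s - pt1 A) \<bullet> bulge A \<ge> 0"
  using assms(1,2) focusing_point[OF assms(3-5)] by (cases s) (auto simp: dispersing_arcs_def)

text \<open>If the line leaves the cap of the arc, it does so beyond \<open>s'\<close> as seen from \<open>s''\<close>: the cap is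
  the intersection of a disc with a half-plane that contains \<open>s''\<close>.\<close>

lemma line_in_disc_height:
  assumes A: "A \<in> dispersing_arcs kd h" "- 2 \<le> kd" "kd < 0" and "0 < h"
    and kf: "0 < kf" "kf \<le> 2"
    and s': "s' \<in> arc_points A" and s'': "s'' \<in> arc_points (focusing_arc kf)"
    and q: "q \<in> line_in_disc A s' s''"
  shows "h \<le> snd q"
proof (rule ccontr)
  assume low: "\<not> h \<le> snd q"
  let ?B = "cball (arc_centre A) (1 / \<bar>curv A\<bar>)"
  let ?H = "{z. (z - pt1 A) \<bullet> bulge A \<ge> 0}"
  have convH: "convex ?H"
  proof -
    have "?H = {z. bulge A \<bullet> z \<ge> bulge A \<bullet> pt1 A}"
      by (simp add: inner_diff_right inner_commute[of _ "bulge A"])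
    then show ?thesis
      by (simp add: convex_halfspace_ge)
  qed
  have cap: "h \<le> snd z" if "z \<in> ?B" "z \<in> ?H" for z
    using dispersing_cap_height[OF A] that by auto
  have kd: "curv A < 0"
    using A by (auto simp: dispersing_arcs_def)
  have sB: "s' \<in> ?B" and sH: "s' \<in> ?H"
    using arc_points_subset_cap[OF s'] by auto
  have s''H: "s'' \<in> ?H"
    using focusing_point_below_cap[OF A(1) \<open>0 < h\<close> kf s''] by simp
  have s''y: "snd s'' \<le> 0"
    using focusing_point[OF kf s''] by simp
  have s'y: "h \<le> snd s'"
    using cap[OF sB sH] .
  have qB: "q \<in> ?B"
    using dispersing_disc_subset[OF s' kd] q by (auto simp: line_in_disc_def)
  then have qH: "q \<notin> ?H"
    using cap low by blast
  \<comment> \<open>The parameter \<open>u\<close> is 0 at \<open>s''\<close> and 1 at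
    \<open>s'\<close>.\<close>
  obtain u where u: "q = (1 - u) *\<^sub>R s'' + u *\<^sub>R s'"
    using q by (auto simp: line_in_disc_def affine_hull_2)
      (metis add.commute add_diff_cancel_right')
  consider "u < 0" | "0 \<le> u" "u \<le> 1" | "1 < u"
    by linarith
  then show False
  proof cases
    \<comment> \<open>Here \<open>s''\<close> lies between \<open>q\<close> and \<open>s'\<close>,
      so convexity of the disc would put \<open>s''\<close> into the cap, which is too high.\<close>
    case 1
    let ?t = "1 / (1 - u)"
    have "s'' = (1 - ?t) *\<^sub>R s' + ?t *\<^sub>R q"
    proof -
      have "?t *\<^sub>R q = s'' + (u / (1 - u)) *\<^sub>R s'"
        using 1 by (simp add: u scaleR_add_right)
      moreover have "1 - ?t = - (u / (1 - u))"
        using 1 by (simp add: field_simps)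
      ultimately show ?thesis
        by simp
    qed
    moreover have "0 \<le> ?t" "?t \<le> 1"
      using 1 by auto
    ultimately have "s'' \<in> ?B"
      using convexD_alt[OF convex_cball sB qB, of ?t] by simp
    then have "h \<le> snd s''"
      using cap s''H by blast
    then show False
      using s''y \<open>0 < h\<close> by linarith
  next
    \<comment> \<open>Here \<open>q\<close> lies between two points of the half-plane, hence in the
      cap.\<close>
    case 2
    then show False
      using convexD_alt[OF convH s''H sH, of u] qH u by simp
  next
    \<comment> \<open>Beyond \<open>s'\<close> the line keeps rising, since \<open>s''\<close> is
      lower than \<open>s'\<close>.\<close>
    case 3
    have "snd q = snd s' + (u - 1) * (snd s' - snd s'')"
      by (simp add: u algebra_simps)
    moreover have "(u - 1) * (snd s' - snd s'') \<ge> 0"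
      using 3 s'y s''y \<open>0 < h\<close> by (intro mult_nonneg_nonneg) auto
    ultimately show False
      using low s'y by linarith
  qed
qed

section \<open>Lower bound and explicit element of the good heights\<close>

lemma good_heights_lower_bound:
  assumes "- 2 \<le> kd" "kd < 0" "0 < kf" "kf \<le> 2" "h \<in> good_heights kd kf"
  shows "3 / 2 * kf \<le> h"
proof -
  let ?A = "Circ_Arc (0, h) (0, 1 + h) kd (1, 0)"
  define c where "c = sqrt ((1 / kf)\<^sup>2 - 1 / 4)"
  have "1 / 2 \<le> 1 / kf"
    using assms by (simp add: field_simps)
  then have "(1 / 2)\<^sup>2 \<le> (1 / kf)\<^sup>2"
    by (intro power_mono) auto
  then have c2: "c\<^sup>2 = (1 / kf)\<^sup>2 - 1 / 4"
    by (simp add: c_def power2_eq_square)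
  have c_le: "c \<le> 1 / kf"
    unfolding c_def using assms by (intro real_le_lsqrt) (auto simp: power2_eq_square)
  have "1 / 2 \<le> 1 / - kd"
    using assms by (simp add: field_simps)
  then have "(1 / 2)\<^sup>2 \<le> (1 / - kd)\<^sup>2"
    by (intro power_mono) auto
  then have kd2: "(1 / kd)\<^sup>2 - 1 / 4 \<ge> 0"
    by (simp add: power2_eq_square)
  have A: "?A \<in> dispersing_arcs kd h"
    by (simp add: dispersing_arcs_def)
  have s': "(0, h) \<in> arc_points ?A"
  proof -
    define a where "a = sqrt ((1 / kd)\<^sup>2 - 1 / 4)"
    have "arc_centre ?A = (- a, h + 1 / 2)"
      by (simp add: a_def arc_centre_def midpoint_def dist_norm norm_Pair power2_eq_square field_simps)
    moreover have "sqrt (a\<^sup>2 + (1 / 2)\<^sup>2) = 1 / \<bar>kd\<bar>"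
    proof -
      have "a\<^sup>2 + (1 / 2)\<^sup>2 = (1 / kd)\<^sup>2"
        using kd2 by (simp add: a_def power2_eq_square)
      then show ?thesis
        by (simp add: real_sqrt_abs)
    qed
    ultimately show ?thesis
      by (simp add: arc_points_def dist_norm norm_Pair)
  qed
  have s'': "(1, 0) \<in> arc_points (focusing_arc kf)"
    using c2 assms by (simp add: arc_points_def focusing_centre dist_norm norm_Pair flip: c_def)
      (simp add: power2_eq_square real_sqrt_divide)
  \<comment> \<open>The point tested is \<open>s'\<close> itself, which lies on the boundary of its
    own disc.\<close>
  have "(0, h) \<in> line_in_disc ?A (0, h) (1, 0)"
    using s' assms by (simp add: line_in_disc_def mem_tangent_disc hull_inc)
  then have "(0, h) \<in> tangent_disc (focusing_arc kf) 4 (1, 0)"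
    using assms(5) A s' s'' unfolding good_heights_def by blast
  then have "1 + h\<^sup>2 \<le> 1 / 2 * (1 / 2 + h * c)"
    using s'' assms by (simp add: mem_tangent_disc focusing_centre norm_Pair flip: c_def)
  \<comment> \<open>The inequality rearranges to
    \<open>h * c \<ge> 3/2 + 2 * h\<^sup>2\<close>.\<close>
  then have "3 / 2 \<le> h * c"
    using zero_le_power2[of h] by argo
  also have "h * c \<le> h * (1 / kf)"
    using assms c_le by (intro mult_left_mono) (auto simp: good_heights_def)
  finally show ?thesis
    using assms by (simp add: field_simps)
qed

text \<open>\<open>M\<close> bounds the distance from \<open>s''\<close> to any point of
  \<open>I(s', s'')\<close>. \<open>C\<close> solves \<open>M\<^sup>2 = 1/2 * (C/2 - M/2)\<close>,
  where \<open>C/2\<close> bounds the vertical part of the inner product from below and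
  \<open>- M/2\<close> the horizontal part.\<close>

lemma good_heights_witness:
  fixes kd kf :: real
  defines "M \<equiv> 1 / \<bar>kd\<bar> + 4"
  defines "C \<equiv> 4 * M\<^sup>2 + M"
  assumes kd: "- 2 \<le> kd" "kd < 0" and "0 < kf" and small: "C * kf \<le> 1"
  shows "C * kf \<in> good_heights kd kf"
proof -
  define h where "h = C * kf"
  have M: "M \<ge> 4"
    by (simp add: M_def)
  then have C: "C \<ge> 1"
    using zero_le_power2[of M] unfolding C_def by linarith
  have "0 < h" "h \<le> 1"
    using small C \<open>0 < kf\<close> by (auto simp: h_def)
  have "kf \<le> 1"
    using small C mult_right_mono[OF C, of kf] \<open>0 < kf\<close> by linarith
  then have kf: "0 < kf" "kf \<le> 2"
    using \<open>0 < kf\<close> by auto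
  define c where "c = sqrt ((1 / kf)\<^sup>2 - 1 / 4)"
  have "1 \<le> 1 / kf"
    using \<open>kf \<le> 1\<close> kf by simp
  then have "1 \<le> (1 / kf)\<^sup>2"
    by (rule one_le_power)
  \<comment> \<open>Half of \<open>1 / kf\<close> is a crude lower bound for \<open>c\<close>; it
    turns \<open>h = C * kf\<close> into \<open>h * c \<ge> C / 2\<close>.\<close>
  then have "(1 / kf / 2)\<^sup>2 \<le> (1 / kf)\<^sup>2 - 1 / 4"
    by (simp add: power2_eq_square field_simps)
  then have c_ge: "1 / kf / 2 \<le> c"
    unfolding c_def by (rule real_le_rsqrt)
  then have "c \<ge> 0"
    using kf by (meson order_trans zero_le_divide_1_iff divide_nonneg_nonneg less_imp_le zero_le_numeral)
  have "C / 2 = h * (1 / kf / 2)"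
    using kf by (simp add: h_def)
  also have "\<dots> \<le> h * c"
    using c_ge \<open>0 < h\<close> by (intro mult_left_mono) auto
  finally have hc: "C / 2 \<le> h * c" .
  have "q \<in> tangent_disc (focusing_arc kf) 4 s''"
    if A: "A \<in> dispersing_arcs kd h" and s': "s' \<in> arc_points A"
      and s'': "s'' \<in> arc_points (focusing_arc kf)" and q: "q \<in> line_in_disc A s' s''" for A s' s'' q
  proof -
    let ?m = "midpoint (pt1 A) (pt2 A)"
    have qy: "h \<le> snd q"
      using line_in_disc_height[OF A kd \<open>0 < h\<close> kf s' s'' q] .
    note f = focusing_point[OF kf s'']
    \<comment> \<open>The path from \<open>q\<close> through \<open>s'\<close>, \<open>?m\<close>
      and the middle of the base to \<open>s''\<close> has length at most
      \<open>1 / \<bar>kd\<bar> + 1/2 + 3 + 1/2 = M\<close>; the 3 relies on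
      \<open>h \<le> 1\<close>.\<close>
    have "dist q s' \<le> 1 / \<bar>kd\<bar>"
      using dispersing_disc_subset(2)[OF s', of q] q A kd
      by (auto simp: line_in_disc_def dispersing_arcs_def)
    moreover have "dist s' ?m \<le> 1 / 2"
      using arc_cap_subset_cball[OF proper_dispersing_arc[OF A kd] arc_points_subset_cap[OF s']] A
      by (auto simp: dispersing_arcs_def dist_norm norm_Pair)
    moreover have "dist ?m (1 / 2, 0) \<le> 3"
    proof -
      have "norm (?m - (1 / 2, 0)) \<le> \<bar>fst (?m - (1 / 2, 0))\<bar> + \<bar>snd (?m - (1 / 2, 0))\<bar>"
        using norm_Pair_le[of "fst (?m - (1 / 2, 0))" "snd (?m - (1 / 2, 0))"]
        by (simp only: prod.collapse real_norm_def)
      also have "\<dots> \<le> 3"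
        using A \<open>0 < h\<close> \<open>h \<le> 1\<close> by (auto simp: dispersing_arcs_def midpoint_def field_simps)
      finally show ?thesis
        by (simp add: dist_norm)
    qed
    moreover have "dist (1 / 2, 0) s'' \<le> 1 / 2"
      using f by (simp add: dist_commute)
    ultimately have d: "dist q s'' \<le> M"
      using dist_triangle[of q s'' s'] dist_triangle[of s' s'' ?m] dist_triangle[of ?m s'' "(1 / 2, 0)"]
      unfolding M_def by linarith
    have "\<bar>fst q - fst s''\<bar> \<le> M"
      using dist_fst_le[of q s''] d by (simp add: dist_real_def)
    moreover have "\<bar>1 / 2 - fst s''\<bar> \<le> 1 / 2"
      using f by linarith
    ultimately have "\<bar>(fst q - fst s'') * (1 / 2 - fst s'')\<bar> \<le> M * (1 / 2)"
      unfolding abs_mult using M by (intro mult_mono) auto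
    then have x: "(fst q - fst s'') * (1 / 2 - fst s'') \<ge> - M / 2"
      by linarith
    have y: "(snd q - snd s'') * (c - snd s'') \<ge> h * c"
      using qy f \<open>c \<ge> 0\<close> \<open>0 < h\<close> by (intro mult_mono) auto
    have "(norm (q - s''))\<^sup>2 \<le> M\<^sup>2"
      using d by (intro power_mono) (auto simp: dist_norm)
    also have "\<dots> \<le> 1 / 2 * ((fst q - fst s'') * (1 / 2 - fst s'') + (snd q - snd s'') * (c - snd s''))"
      using x y hc unfolding C_def by argo
    also have "\<dots> = (2 * sgn kf / 4) * ((q - s'') \<bullet> (arc_centre (focusing_arc kf) - s''))"
      using kf by (cases q; cases s'') (simp add: focusing_centre flip: c_def)
    finally show ?thesis
      using s'' kf by (simp add: mem_tangent_disc)
  qed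
  then show ?thesis
    unfolding good_heights_def using \<open>0 < h\<close> by (auto simp flip: h_def)
qed

section \<open>Closedness of the good heights and existence of the minimum\<close>

text \<open>The chord runs from \<open>s'\<close>, at \<open>\<tau> = 0\<close>, to its other endpoint, at \<open>\<tau> = 1\<close>.\<close>

lemma line_in_disc_param:
  assumes s: "s \<in> arc_points A" and k: "curv A < 0" and "s \<noteq> p"
  shows "line_in_disc A s p =
    (\<lambda>\<tau>. p + (1 + \<tau> * ((s - p) \<bullet> (arc_centre A - s) / (norm (s - p))\<^sup>2)) *\<^sub>R (s - p)) ` {0..1}"
proof -
  define v where "v = s - p"
  define d where "d = arc_centre A - s"
  define r where "r = v \<bullet> d / (norm v)\<^sup>2"
  have nv: "(norm v)\<^sup>2 > 0"
    using assms(3) by (simp add: v_def)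
  have r: "v \<bullet> d = r * (norm v)\<^sup>2"
    using nv by (simp add: r_def)
  \<comment> \<open>The parameter \<open>t\<close> is measured from \<open>s\<close>, so the disc
    inequality has no constant term and its roots are 0 and \<open>r\<close>.\<close>
  have disc: "p + (1 + t) *\<^sub>R v \<in> tangent_disc A (- 2) s \<longleftrightarrow> t\<^sup>2 \<le> t * r" for t
  proof -
    have "p + (1 + t) *\<^sub>R v - s = t *\<^sub>R v"
      by (simp add: v_def algebra_simps)
    then have "p + (1 + t) *\<^sub>R v \<in> tangent_disc A (- 2) s \<longleftrightarrow> t\<^sup>2 * (norm v)\<^sup>2 \<le> (t * r) * (norm v)\<^sup>2"
      using s k by (simp add: mem_tangent_disc r power_mult_distrib mult.assoc flip: d_def)
    also have "\<dots> \<longleftrightarrow> t\<^sup>2 \<le> t * r"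
      using nv by (simp add: mult_le_cancel_right)
    finally show ?thesis .
  qed
  \<comment> \<open>Rescaling by \<open>r\<close> covers both signs of \<open>r\<close> and the
    tangent line \<open>r = 0\<close>, and makes the parameter range independent of the
    height.\<close>
  have param: "t\<^sup>2 \<le> t * r \<longleftrightarrow> (\<exists>\<tau>\<in>{0..1}. t = \<tau> * r)" for t
  proof
    assume t: "t\<^sup>2 \<le> t * r"
    show "\<exists>\<tau>\<in>{0..1}. t = \<tau> * r"
    proof (cases "r = 0")
      case True
      with t show ?thesis
        by (auto intro!: bexI[of _ 0])
    next
      case False
      have "t * (t - r) \<le> 0"
        using t by (simp add: power2_eq_square algebra_simps)
      then have "0 \<le> t \<and> t \<le> r \<or> t \<le> 0 \<and> r \<le> t"
        by (auto simp: mult_le_0_iff)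
      then have "0 \<le> t / r" "t / r \<le> 1"
        using False by (auto simp: divide_simps)
      with False show ?thesis
        by (intro bexI[of _ "t / r"]) auto
    qed
  next
    assume "\<exists>\<tau>\<in>{0..1}. t = \<tau> * r"
    then obtain \<tau> where \<tau>: "0 \<le> \<tau>" "\<tau> \<le> 1" "t = \<tau> * r"
      by auto
    have "\<tau> * \<tau> * r\<^sup>2 \<le> \<tau> * 1 * r\<^sup>2"
      using \<tau> by (intro mult_right_mono mult_left_mono) auto
    then show "t\<^sup>2 \<le> t * r"
      using \<tau> by (simp add: power2_eq_square mult_ac)
  qed
  have aff: "q \<in> affine hull {s, p} \<longleftrightarrow> (\<exists>t. q = p + (1 + t) *\<^sub>R v)" for q
  proof
    assume "q \<in> affine hull {s, p}"
    then obtain a b where ab: "q = a *\<^sub>R s + b *\<^sub>R p" "a + b = 1"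
      by (auto simp: affine_hull_2)
    then have "b = 1 - a"
      by simp
    with ab have "q = p + (1 + (a - 1)) *\<^sub>R v"
      by (simp add: v_def algebra_simps)
    then show "\<exists>t. q = p + (1 + t) *\<^sub>R v"
      by blast
  next
    assume "\<exists>t. q = p + (1 + t) *\<^sub>R v"
    then obtain t where "q = p + (1 + t) *\<^sub>R v" ..
    then have "q = (1 + t) *\<^sub>R s + (- t) *\<^sub>R p" "(1 + t) + (- t) = 1"
      by (simp_all add: v_def algebra_simps)
    then show "q \<in> affine hull {s, p}"
      unfolding affine_hull_2 by blast
  qed
  have "line_in_disc A s p = (\<lambda>\<tau>. p + (1 + \<tau> * r) *\<^sub>R v) ` {0..1}"
  proof (intro set_eqI)
    fix q
    have "q \<in> line_in_disc A s p \<longleftrightarrow> (\<exists>t. q = p + (1 + t) *\<^sub>R v) \<and> q \<in> tangent_disc A (- 2) s"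
      by (simp only: line_in_disc_def Int_iff aff)
    also have "\<dots> \<longleftrightarrow> (\<exists>t. q = p + (1 + t) *\<^sub>R v \<and> t\<^sup>2 \<le> t * r)"
      using disc by blast
    also have "\<dots> \<longleftrightarrow> q \<in> (\<lambda>\<tau>. p + (1 + \<tau> * r) *\<^sub>R v) ` {0..1}"
      unfolding param by blast
    finally show "q \<in> line_in_disc A s p \<longleftrightarrow> q \<in> (\<lambda>\<tau>. p + (1 + \<tau> * r) *\<^sub>R v) ` {0..1}" .
  qed
  then show ?thesis
    unfolding r_def v_def d_def .
qed

lemma closed_good_heights:
  assumes kd: "- 2 \<le> kd" "kd < 0" and kf: "0 < kf" "kf \<le> 2"
  shows "closed (good_heights kd kf)"
proof -
  let ?F = "focusing_arc kf"
  \<comment> \<open>With \<open>s' = s + (0, h)\<close> and \<open>s'' = p\<close>, \<open>v\<close>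
    is \<open>s' - s''\<close> and \<open>g\<close> leads from \<open>s''\<close> to the point
    \<tau> of the chord. The vector \<open>arc_centre A - s\<close> is invariant under the shift, so
    \<open>h\<close> enters only through \<open>v\<close>.\<close>
  define v where "v = (\<lambda>s p h. s + (0, h) - p :: real \<times> real)"
  define g where "g = (\<lambda>A s p \<tau> h.
    (1 + \<tau> * (v s p h \<bullet> (arc_centre A - s) / (norm (v s p h))\<^sup>2)) *\<^sub>R v s p h)"
  define P where "P = (\<lambda>A s p \<tau> h. (norm (g A s p \<tau> h))\<^sup>2 \<le> 1 / 2 * (g A s p \<tau> h \<bullet> (arc_centre ?F - p)))"
  define I where "I = (SIGMA A:dispersing_arcs kd 0. arc_points A \<times> arc_points ?F \<times> {0..1::real})"
  have v0: "v s p h \<noteq> 0" if "A \<in> dispersing_arcs kd 0" "s \<in> arc_points A" "p \<in> arc_points ?F" "h > 0"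
    for A s p h
  proof -
    have "snd (v s p h) > 0"
      using dispersing_point_height[OF that(1) kd that(2)] focusing_point(1)[OF kf that(3)] that(4)
      by (simp add: v_def)
    then show ?thesis
      by auto
  qed
  have step: "line_in_disc (translate_arc (0, h) A) (s + (0, h)) p \<subseteq> tangent_disc ?F 4 p
      \<longleftrightarrow> (\<forall>\<tau>\<in>{0..1}. P A s p \<tau> h)"
    if "A \<in> dispersing_arcs kd 0" "s \<in> arc_points A" "p \<in> arc_points ?F" "h > 0" for A s p h
  proof -
    have "line_in_disc (translate_arc (0, h) A) (s + (0, h)) p = (\<lambda>\<tau>. p + g A s p \<tau> h) ` {0..1}"
      using that v0[OF that] kd
      by (subst line_in_disc_param)
        (auto simp: arc_points_translate arc_centre_translate g_def v_def dispersing_arcs_def)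
    moreover have "p + g A s p \<tau> h \<in> tangent_disc ?F 4 p \<longleftrightarrow> P A s p \<tau> h" for \<tau>
      using that(3) kf by (simp add: mem_tangent_disc P_def)
    ultimately show ?thesis
      by auto
  qed
  have iff: "h \<in> good_heights kd kf \<longleftrightarrow> h > 0 \<and> (\<forall>(A, s, p, \<tau>)\<in>I. P A s p \<tau> h)" for h
  proof (cases "h > 0")
    case True
    have "h \<in> good_heights kd kf \<longleftrightarrow> (\<forall>A\<in>dispersing_arcs kd 0. \<forall>s\<in>arc_points A. \<forall>p\<in>arc_points ?F.
        line_in_disc (translate_arc (0, h) A) (s + (0, h)) p \<subseteq> tangent_disc ?F 4 p)"
      using True
      by (simp add: good_heights_def dispersing_arcs_translate[of kd h] arc_points_translate)
    also have "\<dots> \<longleftrightarrow> (\<forall>A\<in>dispersing_arcs kd 0. \<forall>s\<in>arc_points A. \<forall>p\<in>arc_points ?F.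
        \<forall>\<tau>\<in>{0..1}. P A s p \<tau> h)"
      using step True by (intro ball_cong refl) auto
    finally show ?thesis
      using True by (auto simp: I_def)
  qed (simp add: good_heights_def)
  \<comment> \<open>The condition \<open>h > 0\<close> is not closed; the lower bound allows the
    closed half-line from \<open>?b\<close> to replace it, and there \<open>v\<close> does not
    vanish, so the quotient in \<open>g\<close> is continuous.\<close>
  let ?b = "3 / 2 * kf"
  have "good_heights kd kf = {?b..} \<inter> (\<Inter>(A, s, p, \<tau>)\<in>I. {h \<in> {?b..}. P A s p \<tau> h})"
  proof (intro set_eqI iffI)
    fix h assume h: "h \<in> good_heights kd kf"
    then have "?b \<le> h"
      using good_heights_lower_bound[OF kd kf] by blast
    with h show "h \<in> {?b..} \<inter> (\<Inter>(A, s, p, \<tau>)\<in>I. {h \<in> {?b..}. P A s p \<tau> h})"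
      unfolding iff by auto
  next
    fix h assume h: "h \<in> {?b..} \<inter> (\<Inter>(A, s, p, \<tau>)\<in>I. {h \<in> {?b..}. P A s p \<tau> h})"
    then have "h > 0"
      using kf by (auto intro: less_le_trans[of 0 ?b])
    with h show "h \<in> good_heights kd kf"
      unfolding iff by auto
  qed
  moreover have "closed {h \<in> {?b..}. P A s p \<tau> h}"
    if "A \<in> dispersing_arcs kd 0" "s \<in> arc_points A" "p \<in> arc_points ?F" for A s p \<tau>
  proof -
    have "v s p h \<noteq> 0" if "h \<in> {?b..}" for h
      using v0[of A s p h] that \<open>A \<in> _\<close> \<open>s \<in> _\<close> \<open>p \<in> _\<close> kf by (auto intro: less_le_trans[of 0 ?b])
    moreover have "continuous_on {?b..} (v s p)"
      unfolding v_def by (intro continuous_intros)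
    ultimately have "continuous_on {?b..} (g A s p \<tau>)"
      unfolding g_def by (intro continuous_intros) auto
    then show ?thesis
      unfolding P_def by (intro continuous_on_closed_Collect_le continuous_intros) auto
  qed
  ultimately show ?thesis
    by (auto simp: I_def intro!: closed_Int closed_INT)
qed

text \<open>A nonempty closed set bounded below contains its infimum, and this identifies the
  \<open>LEAST\<close> in \<open>h_o\<close>.\<close>

lemma h_o_minimum:
  assumes "- 2 \<le> kd" "kd < 0" "0 < kf" "kf \<le> 2" "good_heights kd kf \<noteq> {}"
  shows "h_o kd kf \<in> good_heights kd kf" "\<And>h. h \<in> good_heights kd kf \<Longrightarrow> h_o kd kf \<le> h"
proof -
  let ?S = "good_heights kd kf"
  have bdd: "bdd_below ?S"
    using good_heights_lower_bound[OF assms(1-4)] by (rule bdd_belowI)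
  have "Inf ?S \<in> ?S"
    using closed_contains_Inf[OF assms(5) bdd closed_good_heights[OF assms(1-4)]] .
  moreover have le: "Inf ?S \<le> h" if "h \<in> ?S" for h
    using cInf_lower[OF that bdd] .
  ultimately have "h_o kd kf = Inf ?S"
    unfolding h_o_def by (intro Least_equality)
  with \<open>Inf ?S \<in> ?S\<close> le show "h_o kd kf \<in> ?S" "\<And>h. h \<in> ?S \<Longrightarrow> h_o kd kf \<le> h"
    by auto
qed

section \<open>Order of magnitude of the minimal height\<close>

theorem proposition5p1:
  fixes kd :: real
  assumes "- sqrt 2 < kd" and "kd < 0"
  shows "(\<forall>\<^sub>F kf in at_right 0.
            h_o kd kf \<in> good_heights kd kf \<and> (\<forall>h \<in> good_heights kd kf. h_o kd kf \<le> h))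
         \<and> h_o kd \<in> \<Theta>[at_right 0](\<lambda>kf. kf)"
proof -
  have "sqrt 2 \<le> 2"
    by (rule real_le_lsqrt) auto
  then have kd: "- 2 \<le> kd"
    using assms by linarith
  \<comment> \<open>This is the constant of \<open>good_heights_witness\<close>; it depends on
    \<open>kd\<close> only, and \<open>kf < 1 / C\<close> gives the smallness required
    there.\<close>
  define C where "C = 4 * (1 / \<bar>kd\<bar> + 4)\<^sup>2 + (1 / \<bar>kd\<bar> + 4)"
  have "C \<ge> 4"
    unfolding C_def by (simp add: add_increasing)
  have ev: "\<forall>\<^sub>F kf in at_right 0. kf \<in> {0<..<1 / C}"
    using \<open>C \<ge> 4\<close> by (intro eventually_at_right_real) auto
  have good: "C * kf \<in> good_heights kd kf" "kf \<le> 2" if "kf \<in> {0<..<1 / C}" for kf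
  proof -
    have "C * kf \<le> 1"
      using that \<open>C \<ge> 4\<close> by (simp add: field_simps)
    then show "C * kf \<in> good_heights kd kf"
      using good_heights_witness[of kd kf] kd assms(2) that by (simp add: C_def)
    show "kf \<le> 2"
      using \<open>C * kf \<le> 1\<close> mult_right_mono[OF \<open>C \<ge> 4\<close>, of kf] that
      unfolding greaterThanLessThan_iff by linarith
  qed
  have min: "h_o kd kf \<in> good_heights kd kf" "\<And>h. h \<in> good_heights kd kf \<Longrightarrow> h_o kd kf \<le> h"
    if "kf \<in> {0<..<1 / C}" for kf
    using h_o_minimum[of kd kf] good[OF that] kd assms(2) that by auto
  have lower: "3 / 2 * kf \<le> h_o kd kf" if "kf \<in> {0<..<1 / C}" for kf
    using good_heights_lower_bound[OF kd assms(2) _ good(2)[OF that] min(1)[OF that]] that by simp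
  \<comment> \<open>Minimality against the good height \<open>C * kf\<close> gives the upper bound;
    the lower bound applies because \<open>h_o kd kf\<close> is itself good.\<close>
  have "\<forall>\<^sub>F kf in at_right 0. norm (h_o kd kf) \<le> C * norm kf"
    using ev
  proof eventually_elim
    case (elim kf)
    then show ?case
      using min(2)[OF elim good(1)[OF elim]] lower[OF elim] by auto
  qed
  moreover have "\<forall>\<^sub>F kf in at_right 0. 3 / 2 * norm kf \<le> norm (h_o kd kf)"
    using ev
  proof eventually_elim
    case (elim kf)
    then show ?case
      using lower[OF elim] by auto
  qed
  ultimately have "h_o kd \<in> \<Theta>[at_right 0](\<lambda>kf. kf)"
    using \<open>C \<ge> 4\<close> by (intro bigthetaI landau_o.bigI[of C] landau_omega.bigI[of "3 / 2"]) auto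
  moreover have "\<forall>\<^sub>F kf in at_right 0.
      h_o kd kf \<in> good_heights kd kf \<and> (\<forall>h \<in> good_heights kd kf. h_o kd kf \<le> h)"
    using ev by eventually_elim (use min in blast)
  ultimately show ?thesis
    by blast
qed

end
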